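(* Let $G$ be a graph of order $n$ such that $\gamma(G)=\beta(G)$, and let $t\ge 3$ be an integer. The following assertions are equivalent: (a) $\gamma(S(G,t))=n^{t-1}\gamma(G)$; (b) $\xi(G)=0$ and there exists a unique $\gamma(G)$-set.
   Context: A set $D\subseteq V$ is dominating in $G=(V,E)$ if every vertex of $V\setminus D$ has a neighbour in $D$; the domination number $\gamma(G)$ is the minimum cardinality of a dominating set, and a dominating set of cardinality $\gamma(G)$ is a $\gamma(G)$-set. $\beta(G)$ is the vertex cover number (minimum cardinality of a set of vertices meeting every edge). Let $\mathcal D(G)$ be the set of all $\gamma(G)$-sets. Define $\xi(G)=\max_{D\in\mathcal D(G)}\{|D'|:\ D'\subseteq D \text{ and the subgraph induced by } D' \text{ has no isolated vertices}\}$ (the empty set is allowed). For a positive integer $t$, $V^t$ denotes the set of words $u=u_1\cdots u_t$ of length $t$ over $V$. The generalized Sierpiński graph $S(G,t)$ has vertex set $V^t$, and $\{u,v\}$ is an edge if and only if there is $i\in\{1,\dots,t\}$ such that: (i) $u_j=v_j$ for all $j<i$; (ii) $u_i\ne v_i$ and $\{u_i,v_i\}\in E$; (iii) $u_j=v_i$ and $v_j=u_i$ for all $j>i$. *)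

theory Defs
  imports Main
begin

text \<open>The type does not force edges to be two-element sets of vertices; this is part of
  \<open>finite_simple_graph\<close> below.\<close>

type_synonym 'a ugraph = "'a set \<times> 'a set set"

abbreviation verts :: "'a ugraph \<Rightarrow> 'a set" where
  "verts \<equiv> fst"

abbreviation edges :: "'a ugraph \<Rightarrow> 'a set set" where
  "edges \<equiv> snd"

definition finite_simple_graph :: "'a ugraph \<Rightarrow> bool" where
  "finite_simple_graph G \<longleftrightarrow>
     finite (verts G) \<and>
     (\<forall>e\<in>edges G. \<exists>u\<in>verts G. \<exists>v\<in>verts G. u \<noteq> v \<and> e = {u, v})"

definition dominating_set :: "'a ugraph \<Rightarrow> 'a set \<Rightarrow> bool" where
  "dominating_set G D \<longleftrightarrow>
     D \<subseteq> verts G \<and> (\<forall>v\<in>verts G - D. \<exists>u\<in>D. {u, v} \<in> edges G)"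

definition domination_number :: "'a ugraph \<Rightarrow> nat" where
  "domination_number G = Min (card ` {D. dominating_set G D})"

definition gamma_sets :: "'a ugraph \<Rightarrow> 'a set set" where
  "gamma_sets G = {D. dominating_set G D \<and> card D = domination_number G}"

definition vertex_cover :: "'a ugraph \<Rightarrow> 'a set \<Rightarrow> bool" where
  "vertex_cover G C \<longleftrightarrow> C \<subseteq> verts G \<and> (\<forall>e\<in>edges G. e \<inter> C \<noteq> {})"

definition vertex_cover_number :: "'a ugraph \<Rightarrow> nat" where
  "vertex_cover_number G = Min (card ` {C. vertex_cover G C})"

definition induced_subgraph :: "'a ugraph \<Rightarrow> 'a set \<Rightarrow> 'a ugraph" where
  "induced_subgraph G S = (S, {e \<in> edges G. e \<subseteq> S})"

definition isolated_vertex :: "'a ugraph \<Rightarrow> 'a \<Rightarrow> bool" where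
  "isolated_vertex G v \<longleftrightarrow> v \<in> verts G \<and> (\<forall>e\<in>edges G. v \<notin> e)"

definition xi :: "'a ugraph \<Rightarrow> nat" where
  "xi G = Max {card D' | D D'. D \<in> gamma_sets G \<and> D' \<subseteq> D \<and>
                  (\<nexists>v. isolated_vertex (induced_subgraph G D') v)}"

text \<open>Words of length \<open>t\<close> are lists, so positions run from \<open>0\<close> to \<open>t - 1\<close> instead of from
  \<open>1\<close> to \<open>t\<close>.\<close>

definition words :: "'a set \<Rightarrow> nat \<Rightarrow> 'a list set" where
  "words V t = {u. length u = t \<and> set u \<subseteq> V}"

definition sierpinski_adj :: "'a ugraph \<Rightarrow> nat \<Rightarrow> 'a list \<Rightarrow> 'a list \<Rightarrow> bool" where
  "sierpinski_adj G t u v \<longleftrightarrow>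
     (\<exists>i<t. (\<forall>j<i. u ! j = v ! j) \<and>
            u ! i \<noteq> v ! i \<and> {u ! i, v ! i} \<in> edges G \<and>
            (\<forall>j. i < j \<and> j < t \<longrightarrow> u ! j = v ! i \<and> v ! j = u ! i))"

definition sierpinski :: "'a ugraph \<Rightarrow> nat \<Rightarrow> 'a list ugraph" where
  "sierpinski G t =
     (words (verts G) t,
      {{u, v} | u v. u \<in> words (verts G) t \<and> v \<in> words (verts G) t \<and> sierpinski_adj G t u v})"

lemma finite_simple_graph_sierpinski:
  assumes "finite_simple_graph G"
  shows "finite_simple_graph (sierpinski G t)"
proof -
  have "finite (words (verts G) t)"
    using assms finite_lists_length_eq[of "verts G" t]
    by (simp add: finite_simple_graph_def words_def conj_commute)
  moreover have "u \<noteq> v" if "sierpinski_adj G t u v" for u v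
    using that by (auto simp: sierpinski_adj_def)
  ultimately show ?thesis
    by (fastforce simp: finite_simple_graph_def sierpinski_def)
qed

end

theory Submission
  imports Defs
begin

text \<open>Write \<open>S(G,t)\<close> as the union of the copies \<open>wG\<close>, \<open>w\<close> a word of length \<open>t - 1\<close>.
  A vertex \<open>wx\<close> has at most one neighbour outside \<open>wG\<close>, and has one only if \<open>x\<close> is adjacent
  or equal to the last letter of \<open>w\<close>. Condition (b) says exactly that no edge \<open>pq\<close> of \<open>G\<close> has
  \<open>p\<close> and \<open>q\<close> in (possibly equal) \<open>\<gamma>(G)\<close>-sets.

  If \<open>p \<in> D\<close>, \<open>q \<in> D'\<close> is such an edge, put \<open>D - {p}\<close> in the copy \<open>w''qp\<close>, \<open>D'\<close> in the copy
  \<open>w''pq\<close> and \<open>D\<close> in every other copy: \<open>w''qpp\<close> is dominated by \<open>w''pqq\<close>, and \<open>w''qpx\<close> by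
  \<open>w''qxp\<close> when \<open>x\<close> is a neighbour of \<open>p\<close>. This dominating set has \<open>n\<^sup>t\<^sup>-\<^sup>1 \<gamma>(G) - 1\<close> elements.

  If there is no such edge and \<open>X\<close> dominates \<open>S(G,t)\<close>, a copy with fewer than \<open>\<gamma>(G)\<close> elements
  of \<open>X\<close> contains precisely \<open>D - {p}\<close>, \<open>p\<close> being its last letter, and \<open>wp\<close> must be dominated
  from another copy, which then contains more than \<open>\<gamma>(G)\<close> elements of \<open>X\<close>. Distinct
  deficient copies are compensated by distinct copies.\<close>

section \<open>Domination\<close>

lemma finite_simple_graph_edge:
  assumes "finite_simple_graph G" "{a, b} \<in> edges G"
  shows "a \<in> verts G" "b \<in> verts G" "a \<noteq> b"
  using assms by (force simp: finite_simple_graph_def doubleton_eq_iff)+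

lemma finite_dominating_sets:
  assumes "finite (verts G)"
  shows "finite {D. dominating_set G D}"
  by (rule finite_subset[of _ "Pow (verts G)"]) (auto simp: dominating_set_def assms)

lemma domination_number_le:
  assumes "finite (verts G)" "dominating_set G D"
  shows "domination_number G \<le> card D"
  unfolding domination_number_def using assms finite_dominating_sets[OF assms(1)] by (intro Min_le) auto

lemma gamma_sets_nonempty:
  assumes "finite (verts G)"
  obtains D where "D \<in> gamma_sets G"
proof -
  have "dominating_set G (verts G)"
    by (simp add: dominating_set_def)
  then have "domination_number G \<in> card ` {D. dominating_set G D}"
    unfolding domination_number_def
    using finite_dominating_sets[OF assms] by (intro Min_in) auto
  then show ?thesis
    using that by (auto simp: gamma_sets_def)
qed

section \<open>Condition (b) as the absence of edges between \<open>\<gamma>(G)\<close>-sets\<close>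

lemma xi_eq_0_iff:
  assumes G: "finite_simple_graph G"
  shows "xi G = 0 \<longleftrightarrow> (\<forall>D\<in>gamma_sets G. \<forall>p\<in>D. \<forall>q\<in>D. {p, q} \<notin> edges G)"
proof -
  define A where "A = {card D' | D D'. D \<in> gamma_sets G \<and> D' \<subseteq> D \<and>
                  (\<nexists>v. isolated_vertex (induced_subgraph G D') v)}"
  have fin: "finite (verts G)"
    using G by (simp add: finite_simple_graph_def)
  have sub: "D \<subseteq> verts G" if "D \<in> gamma_sets G" for D
    using that by (simp add: gamma_sets_def dominating_set_def)
  have "A \<subseteq> card ` Pow (verts G)"
    unfolding A_def using sub by fast
  then have "finite A"
    using fin by (meson finite_Pow_iff finite_imageI finite_subset)
  moreover obtain D0 where "D0 \<in> gamma_sets G"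
    using gamma_sets_nonempty[OF fin] .
  \<comment> \<open>The empty \<open>D'\<close> makes \<open>A\<close> nonempty, so that the maximum
    is 0 exactly when all elements of \<open>A\<close> are 0.\<close>
  then have "0 \<in> A"
    unfolding A_def
    by (intro CollectI exI[of _ D0] exI[of _ "{}"])
      (auto simp: isolated_vertex_def induced_subgraph_def)
  ultimately have xi: "xi G = 0 \<longleftrightarrow> (\<forall>m\<in>A. m = 0)"
    unfolding xi_def A_def[symmetric] by (subst Max_eq_iff) auto
  show ?thesis
    unfolding xi
  proof (intro iffI ballI notI)
    fix D p q
    assume 0: "\<forall>m\<in>A. m = 0" and D: "D \<in> gamma_sets G" "p \<in> D" "q \<in> D" "{p, q} \<in> edges G"
    have "p \<noteq> q"
      using finite_simple_graph_edge[OF G D(4)] by simp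
    \<comment> \<open>The two ends of an edge induce a subgraph without isolated vertices.\<close>
    moreover have "card {p, q} \<in> A"
      unfolding A_def using D
      by (intro CollectI exI[of _ D] exI[of _ "{p, q}"])
        (auto simp: isolated_vertex_def induced_subgraph_def)
    ultimately show False
      using 0 by auto
  next
    fix m
    assume indep: "\<forall>D\<in>gamma_sets G. \<forall>p\<in>D. \<forall>q\<in>D. {p, q} \<notin> edges G" and "m \<in> A"
    then obtain D D' where D: "D \<in> gamma_sets G" "D' \<subseteq> D" "m = card D'"
      and iso: "\<nexists>v. isolated_vertex (induced_subgraph G D') v"
      unfolding A_def mem_Collect_eq by (elim exE conjE)
    have "v \<notin> D'" for v
    proof
      assume "v \<in> D'"
      then obtain e where e: "e \<in> edges G" "e \<subseteq> D'"
        using iso by (auto simp: isolated_vertex_def induced_subgraph_def)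
      with G obtain a b where "e = {a, b}"
        unfolding finite_simple_graph_def by metis
      with e D indep show False
        by blast
    qed
    then have "D' = {}" by blast
    with D show "m = 0" by simp
  qed
qed

text \<open>Taking \<open>D = D'\<close> on the right gives \<open>xi G = 0\<close>. For uniqueness,
  a vertex of \<open>D'\<close> outside \<open>D\<close> would have a neighbour in \<open>D\<close>,
  which is a forbidden edge; so any two such sets contain each other.\<close>

lemma xi_eq_0_and_unique_gamma_set_iff:
  assumes G: "finite_simple_graph G"
  shows "xi G = 0 \<and> (\<exists>!D. D \<in> gamma_sets G) \<longleftrightarrow>
    (\<forall>D\<in>gamma_sets G. \<forall>D'\<in>gamma_sets G. \<forall>p\<in>D. \<forall>q\<in>D'. {p, q} \<notin> edges G)"
    (is "?L \<longleftrightarrow> ?R")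
proof
  assume ?L
  then show ?R
    using xi_eq_0_iff[OF G] by metis
next
  assume R: ?R
  have fin: "finite (verts G)"
    using G by (simp add: finite_simple_graph_def)
  have sub: "D' \<subseteq> D" if "D \<in> gamma_sets G" "D' \<in> gamma_sets G" for D D'
  proof
    fix q
    assume "q \<in> D'"
    show "q \<in> D"
    proof (rule ccontr)
      assume "q \<notin> D"
      moreover have "dominating_set G D" "D' \<subseteq> verts G"
        using that by (auto simp: gamma_sets_def dominating_set_def)
      ultimately obtain p where "p \<in> D" "{p, q} \<in> edges G"
        using \<open>q \<in> D'\<close> unfolding dominating_set_def by blast
      with R that \<open>q \<in> D'\<close> show False by blast
    qed
  qed
  obtain D0 where "D0 \<in> gamma_sets G"
    using gamma_sets_nonempty[OF fin] .
  then have "\<exists>!D. D \<in> gamma_sets G"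
    using sub by (intro ex1I[of _ D0]) auto
  with R show ?L
    using xi_eq_0_iff[OF G] by blast
qed

section \<open>Edges and copies in Sierpinski graphs\<close>

lemma snoc_in_words_iff: "w @ [x] \<in> words V (Suc m) \<longleftrightarrow> w \<in> words V m \<and> x \<in> V"
  by (auto simp: words_def)

lemma words_SucE:
  assumes "y \<in> words V (Suc m)"
  obtains w x where "y = w @ [x]" "w \<in> words V m" "x \<in> V"
  using assms by (cases y rule: rev_cases) (auto simp: words_def)

lemma finite_words: "finite V \<Longrightarrow> finite (words V m)"
  using finite_lists_length_eq[of V m] by (simp add: words_def conj_commute)

lemma card_words: "finite V \<Longrightarrow> card (words V m) = card V ^ m"
  using card_lists_length_eq[of V m] by (simp add: words_def conj_commute)

lemma card_UN_copies:
  assumes "finite V" "\<And>w. w \<in> words V m \<Longrightarrow> F w \<subseteq> V"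
  shows "card {w @ [x] | w x. w \<in> words V m \<and> x \<in> F w} = (\<Sum>w\<in>words V m. card (F w))"
proof -
  have "{w @ [x] | w x. w \<in> words V m \<and> x \<in> F w} = (\<lambda>(w, x). w @ [x]) ` Sigma (words V m) F"
    by auto
  moreover have "card ((\<lambda>(w, x). w @ [x]) ` Sigma (words V m) F) = card (Sigma (words V m) F)"
    by (rule card_image) (auto simp: inj_on_def)
  moreover have "\<forall>w\<in>words V m. finite (F w)"
    using assms finite_subset by blast
  ultimately show ?thesis
    using card_SigmaI[OF finite_words[OF assms(1), of m]] by simp
qed

text \<open>Here \<open>w\<close> is the common prefix of length \<open>i\<close> and
  \<open>k = t - i - 1\<close>. In this form edges can be compared by list equations instead of by
  positions.\<close>

lemma sierpinski_adj_iff: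
  assumes "length u = t" "length v = t"
  shows "sierpinski_adj G t u v \<longleftrightarrow>
    (\<exists>w a b k. u = w @ a # replicate k b \<and> v = w @ b # replicate k a \<and> a \<noteq> b \<and> {a, b} \<in> edges G)"
    (is "_ \<longleftrightarrow> ?R")
proof
  assume "sierpinski_adj G t u v"
  then obtain i where i: "i < t" "\<forall>j<i. u ! j = v ! j" "u ! i \<noteq> v ! i" "{u ! i, v ! i} \<in> edges G"
    "\<forall>j. i < j \<and> j < t \<longrightarrow> u ! j = v ! i \<and> v ! j = u ! i"
    unfolding sierpinski_adj_def by blast
  have "drop (Suc i) u = replicate (t - Suc i) (v ! i)" "drop (Suc i) v = replicate (t - Suc i) (u ! i)"
    "take i v = take i u"
    using i assms by (auto intro!: nth_equalityI)
  then have "u = take i u @ u ! i # replicate (t - Suc i) (v ! i)"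
    "v = take i u @ v ! i # replicate (t - Suc i) (u ! i)"
    using id_take_nth_drop[of i u] id_take_nth_drop[of i v] i(1) assms by simp_all
  with i show ?R by blast
next
  assume ?R
  then obtain w a b k where *: "u = w @ a # replicate k b" "v = w @ b # replicate k a" "a \<noteq> b"
    "{a, b} \<in> edges G"
    by blast
  show "sierpinski_adj G t u v"
    unfolding sierpinski_adj_def using assms(1) *
    by (intro exI[of _ "length w"]) (auto simp: nth_append nth_Cons')
qed

lemma sierpinski_edge_iff:
  "{u, v} \<in> edges (sierpinski G t) \<longleftrightarrow>
    u \<in> words (verts G) t \<and> v \<in> words (verts G) t \<and>
    (\<exists>w a b k. u = w @ a # replicate k b \<and> v = w @ b # replicate k a \<and> a \<noteq> b \<and> {a, b} \<in> edges G)"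
proof -
  define P where "P u v \<longleftrightarrow>
    (\<exists>w a b k. u = w @ a # replicate k b \<and> v = w @ b # replicate k a \<and> a \<noteq> b \<and> {a, b} \<in> edges G)"
    for u v
  have P_sym: "P v u" if P: "P u v" for u v
  proof -
    obtain w a b k where "u = w @ a # replicate k b" "v = w @ b # replicate k a" "a \<noteq> b"
      "{a, b} \<in> edges G"
      using P unfolding P_def by blast
    then show ?thesis
      unfolding P_def
      by (intro exI[of _ w] exI[of _ b] exI[of _ a] exI[of _ k]) (simp add: insert_commute)
  qed
  have adj: "sierpinski_adj G t u v \<longleftrightarrow> P u v"
    if "u \<in> words (verts G) t" "v \<in> words (verts G) t" for u v
    using that sierpinski_adj_iff[of u t v G] by (simp add: words_def P_def)
  have "{u, v} \<in> edges (sierpinski G t) \<longleftrightarrow>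
    u \<in> words (verts G) t \<and> v \<in> words (verts G) t \<and> P u v"
  proof
    assume "{u, v} \<in> edges (sierpinski G t)"
    then obtain u' v' where "{u, v} = {u', v'}" "u' \<in> words (verts G) t" "v' \<in> words (verts G) t"
      "P u' v'"
      using adj unfolding sierpinski_def by auto
    then show "u \<in> words (verts G) t \<and> v \<in> words (verts G) t \<and> P u v"
      using P_sym by (metis doubleton_eq_iff)
  next
    assume "u \<in> words (verts G) t \<and> v \<in> words (verts G) t \<and> P u v"
    then show "{u, v} \<in> edges (sierpinski G t)"
      using adj unfolding sierpinski_def by auto
  qed
  then show ?thesis
    unfolding P_def .
qed

lemma sierpinski_edge_in_copy:
  assumes "w \<in> words (verts G) m" "finite_simple_graph G" "{x, y} \<in> edges G"
  shows "{w @ [x], w @ [y]} \<in> edges (sierpinski G (Suc m))"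
proof -
  have "w @ [x] = w @ x # replicate 0 y" "w @ [y] = w @ y # replicate 0 x"
    by simp_all
  then show ?thesis
    unfolding sierpinski_edge_iff snoc_in_words_iff
    using assms finite_simple_graph_edge[OF assms(2,3)] by blast
qed

text \<open>The cases are \<open>k = 0\<close>, \<open>k = 1\<close> and \<open>k \<ge> 2\<close>
  for the length \<open>k\<close> of the constant tail. Seen from \<open>w @ [x]\<close>, they
  separate an edge inside the copy, an edge leaving it with \<open>x\<close> adjacent to the last
  letter of \<open>w\<close>, and one leaving it with \<open>x\<close> equal to that letter.\<close>

lemma sierpinski_edgeE:
  assumes "{v @ [y], w @ [x]} \<in> edges (sierpinski G (Suc m))"
  obtains (inner) "v = w" "{y, x} \<in> edges G"
  | (linked) u p where "w = u @ [p]" "v = u @ [x]" "y = p" "{x, p} \<in> edges G"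
  | (outer) u p k where "w = u @ p # replicate (Suc k) x" "v = u @ x # replicate (Suc k) p"
      "y = p" "x \<noteq> p" "{x, p} \<in> edges G"
proof -
  obtain u a b k where *: "v @ [y] = u @ a # replicate k b" "w @ [x] = u @ b # replicate k a"
    "a \<noteq> b" "{a, b} \<in> edges G"
    using assms unfolding sierpinski_edge_iff by blast
  consider "k = 0" | "k = 1" | k' where "k = Suc (Suc k')"
    by (metis One_nat_def not0_implies_Suc)
  then show thesis
  proof cases
    case 1
    with * inner show ?thesis by simp
  next
    case 2
    have snoc: "u @ c # replicate k d = (u @ [c]) @ [d]" for c d
      using 2 by simp
    have "v = u @ [a]" "y = b" "w = u @ [b]" "x = a"
      using *(1,2) unfolding snoc by simp_all
    with * linked[of u b] show ?thesis by simp
  next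
    case 3
    have snoc: "u @ c # replicate k d = (u @ c # replicate (Suc k') d) @ [d]" for c d
      using 3 replicate_append_same[of "Suc k'" d] by simp
    have "v = u @ a # replicate (Suc k') b" "y = b" "w = u @ b # replicate (Suc k') a" "x = a"
      using *(1,2) unfolding snoc by simp_all
    with * outer[of u b k'] show ?thesis by simp
  qed
qed

text \<open>The letter \<open>p\<close> is the last one different from \<open>a\<close>, so the word
  determines where its final run of \<open>a\<close> begins.\<close>

lemma append_replicate_eqD:
  assumes "u @ p # replicate k a = u' @ p' # replicate k' a" "p \<noteq> a" "p' \<noteq> a"
  shows "u = u' \<and> p = p' \<and> k = k'"
  using assms
proof (induction k arbitrary: k')
  case 0
  then show ?case
    \<comment> \<open>The flipped rules expose the last letter: it is \<open>p\<close> on the left,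
      but would be \<open>a\<close> on the right if \<open>k' > 0\<close>.\<close>
    by (cases k') (auto simp flip: replicate_append_same append_Cons append_assoc)
next
  case (Suc k)
  show ?case
  proof (cases k')
    case 0
    with Suc.prems show ?thesis
      by (auto simp flip: replicate_append_same append_Cons append_assoc)
  next
    case (Suc l)
    with Suc.prems have "u @ p # replicate k a = u' @ p' # replicate l a"
      by (simp flip: replicate_append_same append_Cons append_assoc)
    with Suc.IH Suc.prems Suc show ?thesis by blast
  qed
qed

lemma last_append_replicate: "last (u @ p # replicate (Suc k) a) = a"
  by (simp flip: replicate_append_same)

section \<open>Upper bounds\<close>

text \<open>Glues one set \<open>F w\<close> per copy into a dominating set; a vertex may be
  dominated within its own copy or along any edge of the Sierpinski graph.\<close>

lemma domination_number_sierpinski_le_sum: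
  assumes G: "finite_simple_graph G"
    and sub: "\<And>w. w \<in> words (verts G) m \<Longrightarrow> F w \<subseteq> verts G"
    and dom: "\<And>w x. w \<in> words (verts G) m \<Longrightarrow> x \<in> verts G \<Longrightarrow> x \<notin> F w \<Longrightarrow>
      (\<exists>y\<in>F w. {y, x} \<in> edges G) \<or>
      (\<exists>v\<in>words (verts G) m. \<exists>y\<in>F v. {v @ [y], w @ [x]} \<in> edges (sierpinski G (Suc m)))"
  shows "domination_number (sierpinski G (Suc m)) \<le> (\<Sum>w\<in>words (verts G) m. card (F w))"
proof -
  define X where "X = {w @ [x] | w x. w \<in> words (verts G) m \<and> x \<in> F w}"
  have "dominating_set (sierpinski G (Suc m)) X"
    unfolding dominating_set_def
  proof (intro conjI ballI)
    show "X \<subseteq> verts (sierpinski G (Suc m))"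
      using subsetD[OF sub] by (auto simp: X_def sierpinski_def snoc_in_words_iff)
  next
    fix z
    assume z: "z \<in> verts (sierpinski G (Suc m)) - X"
    then have "z \<in> words (verts G) (Suc m)"
      by (simp add: sierpinski_def)
    then obtain w x where z': "z = w @ [x]" and w: "w \<in> words (verts G) m" and "x \<in> verts G"
      by (rule words_SucE)
    moreover have "x \<notin> F w"
      using z w by (auto simp: X_def z')
    ultimately consider y where "y \<in> F w" "{y, x} \<in> edges G"
      | v y where "v \<in> words (verts G) m" "y \<in> F v" "{v @ [y], w @ [x]} \<in> edges (sierpinski G (Suc m))"
      using dom by blast
    then show "\<exists>u\<in>X. {u, z} \<in> edges (sierpinski G (Suc m))"
    proof cases
      case 1
      then show ?thesis
        using sierpinski_edge_in_copy[OF w G, of y x] w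
        by (intro bexI[of _ "w @ [y]"]) (auto simp: X_def z')
    next
      case 2
      then show ?thesis
        by (intro bexI[of _ "v @ [y]"]) (auto simp: X_def z')
    qed
  qed
  moreover have "finite (verts G)"
    using G by (simp add: finite_simple_graph_def)
  ultimately show ?thesis
    using domination_number_le[of "sierpinski G (Suc m)" X] card_UN_copies[of "verts G" m F] sub
    by (simp add: X_def sierpinski_def finite_words)
qed

lemma domination_number_sierpinski_le:
  assumes G: "finite_simple_graph G"
  shows "domination_number (sierpinski G (Suc m)) \<le> card (verts G) ^ m * domination_number G"
proof -
  have fin: "finite (verts G)"
    using G by (simp add: finite_simple_graph_def)
  obtain D where D: "D \<in> gamma_sets G"
    using gamma_sets_nonempty[OF fin] .
  have "domination_number (sierpinski G (Suc m)) \<le> (\<Sum>w\<in>words (verts G) m. card D)"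
    by (rule domination_number_sierpinski_le_sum[OF G])
      (use D in \<open>auto simp: gamma_sets_def dominating_set_def\<close>)
  with D show ?thesis
    by (simp add: gamma_sets_def card_words[OF fin])
qed

lemma domination_number_sierpinski_less:
  assumes G: "finite_simple_graph G" and m: "m \<ge> 2"
    and D: "D \<in> gamma_sets G" "D' \<in> gamma_sets G"
    and pq: "p \<in> D" "q \<in> D'" "{p, q} \<in> edges G"
  shows "domination_number (sierpinski G (Suc m)) < card (verts G) ^ m * domination_number G"
proof -
  have fin: "finite (verts G)"
    using G by (simp add: finite_simple_graph_def)
  have V: "p \<in> verts G" "q \<in> verts G" "p \<noteq> q"
    using finite_simple_graph_edge[OF G pq(3)] by auto
  have sub: "D \<subseteq> verts G" "D' \<subseteq> verts G"
    using D by (auto simp: gamma_sets_def dominating_set_def)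
  then have finD: "finite D"
    using fin finite_subset by blast
  \<comment> \<open>Only the length of this prefix matters; \<open>m \<ge> 2\<close> leaves room for
    the two letters that distinguish the modified copies.\<close>
  define u where "u = replicate (m - 2) p"
  define F where "F w = (if w = u @ [q, p] then D - {p} else if w = u @ [p, q] then D' else D)" for w
  have domD: "\<exists>y\<in>E. {y, x} \<in> edges G" if "E \<in> gamma_sets G" "x \<in> verts G" "x \<notin> E" for E x
    using that by (simp add: gamma_sets_def dominating_set_def)
  have words: "u @ [a, b] \<in> words (verts G) m" if "a \<in> verts G" "b \<in> verts G" for a b
    using that m V by (auto simp: u_def words_def)
  have "domination_number (sierpinski G (Suc m)) \<le> (\<Sum>w\<in>words (verts G) m. card (F w))"
  proof (rule domination_number_sierpinski_le_sum[where F = F, OF G])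
    fix w
    show "F w \<subseteq> verts G"
      unfolding F_def using sub by (simp add: subset_iff)
  next
    fix w x
    assume w: "w \<in> words (verts G) m" "x \<in> verts G" "x \<notin> F w"
    show "(\<exists>y\<in>F w. {y, x} \<in> edges G) \<or>
      (\<exists>v\<in>words (verts G) m. \<exists>y\<in>F v. {v @ [y], w @ [x]} \<in> edges (sierpinski G (Suc m)))"
    proof (cases "w = u @ [q, p]")
      case False
      then have "F w \<in> gamma_sets G"
        using D by (simp add: F_def)
      then show ?thesis
        using domD w by blast
    next
      case w': True
      have link: "\<exists>v\<in>words (verts G) m. \<exists>y\<in>F v. {v @ [y], w @ [x]} \<in> edges (sierpinski G (Suc m))"
        if "{p, x} \<in> edges G"
      proof -
        have "x \<noteq> p"
          using finite_simple_graph_edge[OF G that] by simp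
        \<comment> \<open>As \<open>x \<noteq> p\<close> and \<open>q \<noteq> p\<close>, the copy
          \<open>u @ [q, x]\<close> is neither of the two modified ones and still carries
          \<open>D\<close>.\<close>
        then have "p \<in> F (u @ [q, x])"
          using V pq by (simp add: F_def)
        moreover have "u @ [q, x] \<in> words (verts G) m"
          using words V w by blast
        moreover have "{(u @ [q, x]) @ [p], w @ [x]} \<in> edges (sierpinski G (Suc m))"
          unfolding sierpinski_edge_iff snoc_in_words_iff
          using calculation w V that \<open>x \<noteq> p\<close>
          by (intro conjI exI[of _ "u @ [q]"] exI[of _ x] exI[of _ p] exI[of _ 1])
            (auto simp: w' insert_commute)
        ultimately show ?thesis by blast
      qed
      show ?thesis
      proof (cases "x = p")
        case True
        have "q \<in> F (u @ [p, q])"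
          using V pq by (simp add: F_def)
        moreover have "{(u @ [p, q]) @ [q], w @ [x]} \<in> edges (sierpinski G (Suc m))"
          unfolding sierpinski_edge_iff snoc_in_words_iff
          using w V pq words
          by (intro conjI exI[of _ u] exI[of _ p] exI[of _ q] exI[of _ 2])
            (auto simp: w' True numeral_2_eq_2)
        ultimately show ?thesis
          using words V by blast
      next
        \<comment> \<open>A vertex \<open>x \<noteq> p\<close> outside \<open>D\<close> has a
          neighbour \<open>y\<close> in \<open>D\<close>: either \<open>y\<close> survives in
          \<open>D - {p}\<close>, or \<open>y = p\<close> and \<open>link\<close> replaces
          it.\<close>
        case False
        then obtain y where "y \<in> D" "{y, x} \<in> edges G"
          using domD[OF D(1) w(2)] w(3) by (auto simp: F_def w')
        moreover have "F w = D - {p}"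
          by (simp add: F_def w')
        ultimately show ?thesis
          using link by blast
      qed
    qed
  qed
  also have "\<dots> < (\<Sum>w\<in>words (verts G) m. domination_number G)"
  proof (rule sum_strict_mono_ex1)
    have "card (D - {p}) < card D"
      using finD pq(1) by (rule card_Diff1_less)
    then show "\<forall>w\<in>words (verts G) m. card (F w) \<le> domination_number G"
      using D by (simp add: F_def gamma_sets_def)
    have "card (F (u @ [q, p])) < domination_number G"
      using \<open>card (D - {p}) < card D\<close> D by (simp add: F_def gamma_sets_def)
    then show "\<exists>w\<in>words (verts G) m. card (F w) < domination_number G"
      using words V by blast
  qed (rule finite_words[OF fin])
  also have "\<dots> = card (verts G) ^ m * domination_number G"
    by (simp add: card_words[OF fin])
  finally show ?thesis .
qed

section \<open>Lower bound\<close>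

text \<open>A vertex \<open>w @ [x]\<close> with \<open>x \<noteq> last w\<close> that is dominated
  from another copy has \<open>x\<close> adjacent to \<open>last w\<close>, so adding this one
  letter repairs the trace of \<open>X\<close> on the copy.\<close>

lemma dominating_set_insert_last:
  assumes X: "dominating_set (sierpinski G (Suc m)) X"
    and w: "w \<in> words (verts G) m" and m: "m \<ge> 1"
  shows "dominating_set G (insert (last w) {x. w @ [x] \<in> X})"
proof -
  have XV: "X \<subseteq> words (verts G) (Suc m)"
    using X by (simp add: dominating_set_def sierpinski_def)
  have "last w \<in> verts G"
    using w m last_in_set[of w] by (cases "w = []") (auto simp: words_def)
  moreover have "\<exists>y\<in>insert (last w) {x. w @ [x] \<in> X}. {y, x} \<in> edges G"
    if x: "x \<in> verts G" "w @ [x] \<notin> X" "x \<noteq> last w" for x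
  proof -
    have "w @ [x] \<in> verts (sierpinski G (Suc m)) - X"
      using x w by (simp add: sierpinski_def snoc_in_words_iff)
    then obtain z where z: "z \<in> X" "{z, w @ [x]} \<in> edges (sierpinski G (Suc m))"
      using X by (auto simp: dominating_set_def)
    then obtain v y where "z = v @ [y]"
      using XV words_SucE by blast
    with z(2) have "{v @ [y], w @ [x]} \<in> edges (sierpinski G (Suc m))"
      by simp
    then show ?thesis
    proof (cases rule: sierpinski_edgeE)
      case inner
      with z \<open>z = v @ [y]\<close> show ?thesis by auto
    next
      case (linked u p)
      then show ?thesis by (auto simp: insert_commute)
    next
      case (outer u p k)
      have "last w = x"
        unfolding outer(1) by (rule last_append_replicate)
      then show ?thesis using x by simp
    qed
  qed
  ultimately show ?thesis
    using XV by (auto simp: dominating_set_def snoc_in_words_iff)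
qed

lemma domination_number_sierpinski_ge:
  assumes G: "finite_simple_graph G" and m: "m \<ge> 1"
    and indep: "\<And>D D' p q. D \<in> gamma_sets G \<Longrightarrow> D' \<in> gamma_sets G \<Longrightarrow> p \<in> D \<Longrightarrow> q \<in> D' \<Longrightarrow>
      {p, q} \<notin> edges G"
  shows "card (verts G) ^ m * domination_number G \<le> domination_number (sierpinski G (Suc m))"
proof -
  let ?W = "words (verts G) m" and ?g = "domination_number G"
  have fin: "finite (verts G)"
    using G by (simp add: finite_simple_graph_def)
  have "finite (verts (sierpinski G (Suc m)))"
    by (simp add: sierpinski_def finite_words[OF fin])
  then obtain X where "X \<in> gamma_sets (sierpinski G (Suc m))"
    by (rule gamma_sets_nonempty)
  then have X: "dominating_set (sierpinski G (Suc m)) X"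
    and cardX: "card X = domination_number (sierpinski G (Suc m))"
    by (auto simp: gamma_sets_def)
  define F where "F w = {x. w @ [x] \<in> X}" for w
  have XV: "X \<subseteq> words (verts G) (Suc m)"
    using X by (simp add: dominating_set_def sierpinski_def)
  then have FV: "F w \<subseteq> verts G" for w
    by (auto simp: F_def snoc_in_words_iff)
  then have finF: "finite (F w)" for w
    using fin finite_subset by blast
  have "X = {w @ [x] | w x. w \<in> ?W \<and> x \<in> F w}"
    using XV by (fastforce simp: F_def snoc_in_words_iff elim: words_SucE)
  then have sumF: "card X = (\<Sum>w\<in>?W. card (F w))"
    using card_UN_copies[OF fin FV] by simp
  have dom: "dominating_set G (insert (last w) (F w))" if "w \<in> ?W" for w
    using dominating_set_insert_last[OF X that m] by (simp add: F_def)

  \<comment> \<open>\<open>R w v\<close> records the position of two copies joined by an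
    \<open>outer\<close> edge. By \<open>R_inj\<close> the compensating copy \<open>v\<close>
    determines the deficient copy \<open>w\<close>: its last letter is \<open>q\<close>, and the
    final run of \<open>q\<close> then fixes \<open>u\<close>, \<open>p\<close> and
    \<open>k\<close>.\<close>
  define R where "R w v \<longleftrightarrow> (\<exists>u p q k. w = u @ q # replicate (Suc k) p \<and>
    v = u @ p # replicate (Suc k) q \<and> p \<noteq> q)" for w v :: "'a list"
  have R_inj: "w = w'" if R: "R w v" "R w' v" for w w' v
  proof -
    obtain u p q k where 1: "w = u @ q # replicate (Suc k) p" "v = u @ p # replicate (Suc k) q" "p \<noteq> q"
      using R(1) unfolding R_def by blast
    obtain u' p' q' k' where 2: "w' = u' @ q' # replicate (Suc k') p'"
      "v = u' @ p' # replicate (Suc k') q'" "p' \<noteq> q'"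
      using R(2) unfolding R_def by blast
    have "last v = q" "last v = q'"
      using 1(2) 2(2) last_append_replicate by metis+
    with 1 2 append_replicate_eqD[of u p "Suc k" q u' p' "Suc k'"] show ?thesis
      by simp
  qed
  define B where "B = {w \<in> ?W. card (F w) < ?g}"
  have compensate: "?g \<le> Suc (card (F w)) \<and> (\<exists>v\<in>?W. R w v \<and> ?g < card (F v))" if "w \<in> B" for w
  proof -
    have w: "w \<in> ?W" "card (F w) < ?g"
      using that by (auto simp: B_def)
    let ?p = "last w"
    have "?g \<le> card (insert ?p (F w))"
      by (rule domination_number_le[OF fin dom[OF w(1)]])
    moreover have "card (insert ?p (F w)) \<le> Suc (card (F w))"
      by (simp add: card_insert_if finF)
    \<comment> \<open>Since \<open>card (F w) < ?g\<close>, both preceding bounds are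
      equalities.\<close>
    ultimately have "insert ?p (F w) \<in> gamma_sets G" and g: "?g \<le> Suc (card (F w))" and "?p \<notin> F w"
      using w dom[OF w(1)] by (auto simp: gamma_sets_def insert_absorb)
    have "?p \<in> verts G"
      using dom[OF w(1)] by (auto simp: dominating_set_def)
    then have "w @ [?p] \<in> verts (sierpinski G (Suc m)) - X"
      using w \<open>?p \<notin> F w\<close> by (simp add: sierpinski_def snoc_in_words_iff F_def)
    then obtain z where z: "z \<in> X" "{z, w @ [?p]} \<in> edges (sierpinski G (Suc m))"
      using X by (auto simp: dominating_set_def)
    then obtain v y where vy: "z = v @ [y]" "v \<in> ?W"
      using XV words_SucE by blast
    with z have y: "y \<in> F v"
      by (simp add: F_def)
    have "{v @ [y], w @ [?p]} \<in> edges (sierpinski G (Suc m))"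
      using z vy by simp
    then have "R w v \<and> last v = y \<and> {?p, y} \<in> edges G"
    proof (cases rule: sierpinski_edgeE)
      \<comment> \<open>This would be an edge within a single
        \<open>\<gamma>(G)\<close>-set.\<close>
      case inner
      then show ?thesis
        using indep[of "insert ?p (F w)" "insert ?p (F w)" y ?p] y
          \<open>insert ?p (F w) \<in> gamma_sets G\<close> by simp
    next
      \<comment> \<open>Here \<open>last w\<close> is \<open>p\<close> as well as the added letter,
        so the edge would be a loop.\<close>
      case (linked u p)
      then show ?thesis
        using finite_simple_graph_edge(3)[OF G] by fastforce
    next
      case (outer u p k)
      moreover have "R w v"
        unfolding R_def using outer(1,2,4) by blast
      moreover have "last v = p"
        unfolding outer(2) by (rule last_append_replicate)
      ultimately show ?thesis by simp
    qed
    then have "F v \<notin> gamma_sets G"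
      using indep[of "insert ?p (F w)" "F v" ?p y] y \<open>insert ?p (F w) \<in> gamma_sets G\<close> by blast
    \<comment> \<open>The dominating letter \<open>y\<close> is the last letter of \<open>v\<close>
      and lies in \<open>F v\<close>, so nothing has to be added; not being minimum,
      \<open>F v\<close> is then too large.\<close>
    moreover have "dominating_set G (F v)"
      using dom[OF vy(2)] y \<open>R w v \<and> last v = y \<and> {?p, y} \<in> edges G\<close> by (simp add: insert_absorb)
    ultimately have "?g < card (F v)"
      using domination_number_le[OF fin, of "F v"] by (simp add: gamma_sets_def)
    with g vy \<open>R w v \<and> last v = y \<and> {?p, y} \<in> edges G\<close> show ?thesis
      by blast
  qed
  then obtain f where f: "\<And>w. w \<in> B \<Longrightarrow> f w \<in> ?W \<and> R w (f w) \<and> ?g < card (F (f w))"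
    by metis
  have "inj_on f B"
    using f R_inj by (metis inj_onI)
  then have card_fB: "card (f ` B) = card B"
    by (rule card_image)
  \<comment> \<open>A copy in \<open>B\<close> lacks exactly one element, and one in the image of
    \<open>f\<close> has at least one to spare, so no copy is both. After summation the two
    corrections cancel because \<open>f\<close> is injective on \<open>B\<close>.\<close>
  have "?g + of_bool (w \<in> f ` B) \<le> card (F w) + of_bool (w \<in> B)" if "w \<in> ?W" for w
    using f compensate that by (fastforce simp: B_def)
  then have "(\<Sum>w\<in>?W. ?g + of_bool (w \<in> f ` B)) \<le> (\<Sum>w\<in>?W. card (F w) + of_bool (w \<in> B))"
    by (rule sum_mono)
  moreover have "(\<Sum>w\<in>?W. of_bool (w \<in> C)) = card C" if "C \<subseteq> ?W" for C
    using that finite_words[OF fin] by (simp add: Int_absorb1 of_bool_def sum.If_cases)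
  moreover have "B \<subseteq> ?W" "f ` B \<subseteq> ?W"
    using f by (auto simp: B_def)
  ultimately show ?thesis
    using card_fB sumF cardX by (simp add: sum.distrib card_words[OF fin])
qed

theorem theorem15:
  fixes G :: "'a ugraph" and n t :: nat
  assumes "finite_simple_graph G"
    and "n = card (verts G)"
    and "domination_number G = vertex_cover_number G"
    and "t \<ge> 3"
  shows "domination_number (sierpinski G t) = n ^ (t - 1) * domination_number G \<longleftrightarrow>
         xi G = 0 \<and> (\<exists>!D. D \<in> gamma_sets G)"
proof -
  \<comment> \<open>\<open>m\<close> is the length of the words that name the copies of
    \<open>G\<close>.\<close>
  define m where "m = t - 1"
  have t: "t = Suc m" "m \<ge> 2"
    using assms(4) by (auto simp: m_def)
  show ?thesis
    unfolding xi_eq_0_and_unique_gamma_set_iff[OF assms(1)]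
  proof (intro iffI ballI notI)
    assume eq: "domination_number (sierpinski G t) = n ^ (t - 1) * domination_number G"
    fix D D' p q
    assume "D \<in> gamma_sets G" "D' \<in> gamma_sets G" "p \<in> D" "q \<in> D'" "{p, q} \<in> edges G"
    then have "domination_number (sierpinski G (Suc m)) < card (verts G) ^ m * domination_number G"
      by (rule domination_number_sierpinski_less[OF assms(1) t(2)])
    with eq show False
      by (simp add: t assms(2))
  next
    assume "\<forall>D\<in>gamma_sets G. \<forall>D'\<in>gamma_sets G. \<forall>p\<in>D. \<forall>q\<in>D'. {p, q} \<notin> edges G"
    then have "card (verts G) ^ m * domination_number G \<le> domination_number (sierpinski G (Suc m))"
      using domination_number_sierpinski_ge[OF assms(1), of m] t(2) by force
    then show "domination_number (sierpinski G t) = n ^ (t - 1) * domination_number G"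
      using domination_number_sierpinski_le[OF assms(1), of m] by (simp add: t assms(2))
  qed
qed

end
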